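(* Let $a<b<c$ be pairwise relatively prime positive integers. Then $(a,b,c)$ is UM if and only if $c\in S(a,b)$.
   Context: A partition is a finite (possibly empty) nonincreasing sequence $\lambda=(\lambda_1,\dots,\lambda_r)$ of positive integers; $r$ is its length. A partition $\mu=(\mu_1,\dots,\mu_s)$ is a subpartition of $\lambda$ (written $\mu\subseteq\lambda$, and one says $\lambda$ contains $\mu$) if $s\le r$ and $\mu_i\le\lambda_i$ for all $1\le i\le s$. The Young diagram of $\lambda$ has $r$ left-justified rows, with $\lambda_i$ cells in row $i$. The hook length of a cell is the number of cells that are in the same row to its right, or in the same column below it, or equal to it. For a finite set $A$ of positive integers, an $A$-core is a partition no cell of whose Young diagram has hook length in $A$; $C(A)$ denotes the set of $A$-cores. The set $A$ is UM if there is an $A$-core $\kappa_A$ that contains every other $A$-core as a subpartition. A triple $(a,b,c)$ is called UM if the set $\{a,b,c\}$ is UM. $S(a,b)$ is the numerical semigroup generated by $a$ and $b$, i.e. the set of all linear combinations of $a$ and $b$ with nonnegative integer coefficients. *)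

theory Defs
  imports Main
begin

definition is_partition :: "nat list \<Rightarrow> bool" where
  "is_partition l \<longleftrightarrow> sorted_wrt (\<ge>) l \<and> (\<forall>x\<in>set l. 0 < x)"

definition subpartition :: "nat list \<Rightarrow> nat list \<Rightarrow> bool" where
  "subpartition m l \<longleftrightarrow> length m \<le> length l \<and> (\<forall>i<length m. m ! i \<le> l ! i)"

text \<open>Rows and columns are numbered from 0, rows from top to bottom.\<close>

definition young_diagram :: "nat list \<Rightarrow> (nat \<times> nat) set" where
  "young_diagram l = {(i, j). i < length l \<and> j < l ! i}"

definition hook :: "nat list \<Rightarrow> nat \<times> nat \<Rightarrow> (nat \<times> nat) set" where
  "hook l = (\<lambda>(i, j). {(i', j') \<in> young_diagram l.
     (i' = i \<and> j < j') \<or> (j' = j \<and> i < i') \<or> (i', j') = (i, j)})"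

definition hook_length :: "nat list \<Rightarrow> nat \<times> nat \<Rightarrow> nat" where
  "hook_length l x = card (hook l x)"

definition cores :: "nat set \<Rightarrow> nat list set" where
  "cores A = {l. is_partition l \<and> (\<forall>x\<in>young_diagram l. hook_length l x \<notin> A)}"

text \<open>The notion is meant for finite sets of positive integers. Since \<^const>\<open>subpartition\<close> is
  reflexive, quantifying over all cores is the same as over the cores other than \<open>k\<close>.\<close>

definition UM :: "nat set \<Rightarrow> bool" where
  "UM A \<longleftrightarrow> (\<exists>k\<in>cores A. \<forall>l\<in>cores A. subpartition l k)"

definition UM_triple :: "nat \<Rightarrow> nat \<Rightarrow> nat \<Rightarrow> bool" where
  "UM_triple a b c \<longleftrightarrow> UM {a, b, c}"

definition semigroup_gen :: "nat \<Rightarrow> nat \<Rightarrow> nat set" where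
  "semigroup_gen a b = {x * a + y * b | x y. True}"

end

theory Submission
  imports Defs "HOL-Number_Theory.Cong"
begin

text \<open>Partitions are encoded by their sets of first-column hook lengths (beta sets); \<open>A\<close>-cores
  correspond to the finite sets \<open>X\<close> of positive integers closed under subtracting elements of \<open>A\<close>
  as long as the result is nonnegative. Hence an \<open>A\<close>-core containing all others can only have the
  gaps of the semigroup generated by \<open>A\<close> as its beta set.

  If \<open>c \<in> S(a, b)\<close>, then \<open>(a, b, c)\<close>-cores and \<open>(a, b)\<close>-cores coincide, and one needs Vandehey's
  theorem that the gaps of \<open>S(a, b)\<close> give a largest \<open>(a, b)\<close>-core. Conversely, a largest core is
  self-conjugate, so the semigroup generated by \<open>a, b, c\<close> is symmetric; by Herzog's argument this is
  impossible for pairwise coprime \<open>a < b < c\<close> with \<open>c \<notin> S(a, b)\<close>.\<close>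

section \<open>Beta sets\<close>

text \<open>In a partition all rows are nonempty, so the leg of the cell \<open>(i, 0)\<close>
  consists of all \<open>length l - 1 - i\<close> lower rows.\<close>

definition first_hook :: "nat list \<Rightarrow> nat \<Rightarrow> nat" where
  "first_hook l i = l ! i + (length l - 1 - i)"

definition beta :: "nat list \<Rightarrow> nat set" where
  "beta l = first_hook l ` {..<length l}"

text \<open>The case \<open>k = x\<close> counts: if \<open>0 \<notin> X\<close>, it keeps the
  elements of \<open>A\<close> themselves out of \<open>X\<close>.\<close>

definition sub_closed :: "nat set \<Rightarrow> nat set \<Rightarrow> bool" where
  "sub_closed A X \<longleftrightarrow> (\<forall>x\<in>X. \<forall>k\<in>A. k \<le> x \<longrightarrow> x - k \<in> X)"

lemma partition_nth_mono:
  assumes "is_partition l" "i \<le> j" "j < length l"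
  shows "l ! j \<le> l ! i"
  using assms sorted_wrt_nth_less[of "(\<ge>)" l i j]
  by (cases "i = j") (auto simp: is_partition_def)

lemma partition_nth_pos: "is_partition l \<Longrightarrow> i < length l \<Longrightarrow> 0 < l ! i"
  by (auto simp: is_partition_def)

lemma beta_less:
  assumes "is_partition l" "i < j" "j < length l"
  shows "first_hook l j < first_hook l i"
  using partition_nth_mono[of l i j] assms by (auto simp: first_hook_def)

lemma beta_le_iff:
  assumes "is_partition l" "i < length l" "j < length l"
  shows "first_hook l j \<le> first_hook l i \<longleftrightarrow> i \<le> j"
  using beta_less[OF assms(1), of i j] beta_less[OF assms(1), of j i] assms
  by (cases i j rule: linorder_cases) auto

lemma inj_on_beta:
  assumes "is_partition l"
  shows "inj_on (first_hook l) {..<length l}"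
proof (rule inj_onI)
  fix i j assume *: "i \<in> {..<length l}" "j \<in> {..<length l}"
    "first_hook l i = first_hook l j"
  with beta_le_iff[OF assms, of i j] beta_le_iff[OF assms, of j i] show "i = j" by auto
qed

lemma card_beta: "is_partition l \<Longrightarrow> card (beta l) = length l"
  unfolding beta_def by (simp add: card_image inj_on_beta)

lemma finite_beta [simp]: "finite (beta l)"
  by (simp add: beta_def)

lemma zero_notin_beta: "is_partition l \<Longrightarrow> 0 \<notin> beta l"
  using partition_nth_pos[of l] by (fastforce simp: beta_def first_hook_def)

lemma card_beta_ge:
  assumes "is_partition l" "i < length l"
  shows "card {y \<in> beta l. first_hook l i \<le> y} = Suc i"
proof -
  have "{y \<in> beta l. first_hook l i \<le> y} = first_hook l ` {..i}"
    using beta_le_iff[OF assms(1) _ assms(2)] assms(2) by (fastforce simp: beta_def)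
  moreover have "inj_on (first_hook l) {..i}"
    by (rule inj_on_subset[OF inj_on_beta[OF assms(1)]]) (use assms(2) in auto)
  ultimately show ?thesis by (simp add: card_image)
qed

text \<open>Together with \<open>card_beta_ge\<close> this recovers row index and row length from
  the beta set: the beta elements below \<open>first_hook l i\<close> are those of the
  \<open>length l - 1 - i\<close> lower rows.\<close>

lemma card_non_beta_less:
  assumes "is_partition l" "i < length l"
  shows "card {n. n < first_hook l i \<and> n \<notin> beta l} = l ! i"
proof -
  let ?x = "first_hook l i"
  have "beta l = {y \<in> beta l. ?x \<le> y} \<union> {y \<in> beta l. y < ?x}" by auto
  then have "card (beta l) = card {y \<in> beta l. ?x \<le> y} + card {y \<in> beta l. y < ?x}"
    using card_Un_disjoint[of "{y \<in> beta l. ?x \<le> y}" "{y \<in> beta l. y < ?x}"] by fastforce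
  then have less: "card {y \<in> beta l. y < ?x} = length l - 1 - i"
    using card_beta[OF assms(1)] card_beta_ge[OF assms] by simp
  have "{n. n < ?x \<and> n \<notin> beta l} = {..<?x} - {y \<in> beta l. y < ?x}" by auto
  then have "card {n. n < ?x \<and> n \<notin> beta l} = ?x - card {y \<in> beta l. y < ?x}"
    by (simp add: card_Diff_subset subset_iff)
  then show ?thesis using less by (simp add: first_hook_def)
qed

lemma beta_Cons: "beta (x # l) = insert (x + length l) (beta l)"
proof -
  have "{..<length (x # l)} = insert 0 (Suc ` {..<length l})"
    by (simp add: lessThan_Suc_eq_insert_0)
  then show ?thesis by (simp add: beta_def first_hook_def image_image)
qed

text \<open>Elements are added in increasing order: a new maximum \<open>m\<close> becomes a new top
  row of length \<open>m - length l\<close>, which leaves the first hooks of the other rows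
  unchanged.\<close>

lemma ex_partition_beta:
  assumes "finite X" "0 \<notin> X"
  shows "\<exists>l. is_partition l \<and> beta l = X"
  using assms
proof (induction X rule: finite_linorder_max_induct)
  case empty
  show ?case by (rule exI[of _ "[]"]) (simp add: is_partition_def beta_def)
next
  case (insert m X)
  then obtain l where l: "is_partition l" "beta l = X" by auto
  have m: "0 < m" using insert.prems by (cases m) auto
  have hd: "l ! 0 + length l \<le> m" if "l \<noteq> []"
  proof -
    have "first_hook l 0 \<in> beta l" using that by (auto simp: beta_def)
    with insert.hyps l have "first_hook l 0 < m" by auto
    with that show ?thesis by (cases l) (auto simp: first_hook_def)
  qed
  have len: "length l < m"
    using hd m partition_nth_pos[OF l(1), of 0] by (cases l) auto
  have "l ! 0 \<ge> y" if "y \<in> set l" for y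
    using that partition_nth_mono[OF l(1), of 0] by (auto simp: in_set_conv_nth)
  with hd have "y \<le> m - length l" if "y \<in> set l" for y
    using that by (cases l) fastforce+
  with l(1) len have "is_partition ((m - length l) # l)"
    by (auto simp: is_partition_def)
  moreover have "beta ((m - length l) # l) = insert m X"
    using l(2) len by (simp add: beta_Cons)
  ultimately show ?case by blast
qed

section \<open>Hook lengths, cores and containment in terms of beta sets\<close>

lemma down_closed_eq_lessThan:
  fixes I :: "nat set"
  assumes "finite I" "\<And>i j. j \<in> I \<Longrightarrow> i \<le> j \<Longrightarrow> i \<in> I"
  shows "I = {..<card I}"
proof (cases "I = {}")
  case False
  have "I = {..Max I}"
  proof
    show "I \<subseteq> {..Max I}" using assms(1) by auto
    show "{..Max I} \<subseteq> I" using assms(2) Max_in[OF assms(1) False] by blast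
  qed
  moreover from arg_cong[OF this, of card] have "card I = Suc (Max I)" by (simp only: card_atMost)
  ultimately show ?thesis by (simp only: lessThan_Suc_atMost)
qed simp

text \<open>Read the boundary of the diagram from the bottom left, numbering its steps from 0:
  up-steps sit at the beta elements, right-steps at the other numbers. A hook joins the up-step of
  its row to an earlier right-step, and its length is their distance.\<close>

lemma hook_lengths_row:
  assumes l: "is_partition l" and i: "i < length l"
  defines "x \<equiv> first_hook l i"
  shows "(\<lambda>j. hook_length l (i, j)) ` {..<l ! i} = (\<lambda>y. x - y) ` {y. y < x \<and> y \<notin> beta l}"
proof -
  define col where "col j = card {i'. i' < length l \<and> j < l ! i'}" for j
  have col: "i' < length l \<and> j < l ! i' \<longleftrightarrow> i' < col j" for i' j
  proof -
    have "{i'. i' < length l \<and> j < l ! i'} = {..<col j}" unfolding col_def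
      using partition_nth_mono[OF l] by (intro down_closed_eq_lessThan) (auto intro: less_le_trans)
    then show ?thesis by auto
  qed
  have col_le: "col j \<le> length l" for j
    using col[of "length l" j] by (meson less_irrefl not_le_imp_less)
  have col_mono: "col j' \<le> col j" if "j \<le> j'" for j j'
  proof (rule ccontr)
    assume "\<not> col j' \<le> col j"
    then have "col j < col j'" by simp
    with col[of "col j" j'] col[of "col j" j] that show False by auto
  qed
  \<comment> \<open>Position of the right-step under column \<open>j\<close>: before it come
    \<open>j\<close> right-steps and one up-step for each row not reaching column
    \<open>j\<close>.\<close>
  define y where "y j = j + (length l - col j)" for j
  have y_less: "y j < y j'" if "j < j'" for j j'
    using col_mono[of j j'] that by (auto simp: y_def)
  \<comment> \<open>A row reaching column \<open>j\<close> has a larger first hook, any other row a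
    smaller one.\<close>
  have y_notin: "y j \<notin> beta l" for j
  proof
    assume "y j \<in> beta l"
    then obtain i' where i': "i' < length l" "y j = first_hook l i'"
      by (auto simp: beta_def)
    then show False using col[of i' j] col_le[of j] by (cases "j < l ! i'") (auto simp: y_def first_hook_def)
  qed
  have y_lt: "y j < x" if "j < l ! i" for j
    using col[of i j] that i col_le[of j] by (auto simp: y_def x_def first_hook_def)
  have "inj_on y {..<l ! i}"
    by (intro linorder_inj_onI) (use y_less in force)+
  then have "card (y ` {..<l ! i}) = l ! i" by (simp add: card_image)
  moreover have "card {n. n < x \<and> n \<notin> beta l} = l ! i"
    using card_non_beta_less[OF l i] by (simp add: x_def)
  moreover have "y ` {..<l ! i} \<subseteq> {n. n < x \<and> n \<notin> beta l}"
    using y_lt y_notin by auto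
  ultimately have y_img: "y ` {..<l ! i} = {n. n < x \<and> n \<notin> beta l}"
    by (intro card_subset_eq) auto
  have "hook_length l (i, j) = x - y j" if j: "j < l ! i" for j
  proof -
    have "hook l (i, j) = {i} \<times> {j..<l ! i} \<union> {i<..<col j} \<times> {j}"
      using i j by (auto simp: hook_def young_diagram_def col[symmetric])
    moreover have "({i} \<times> {j..<l ! i}) \<inter> ({i<..<col j} \<times> {j}) = {}" by auto
    ultimately have "hook_length l (i, j) = (l ! i - j) + (col j - Suc i)"
      unfolding hook_length_def by (simp add: card_Un_disjoint card_cartesian_product)
    then show ?thesis using col[of i j] col_le[of j] i j by (auto simp: x_def y_def first_hook_def)
  qed
  then have "(\<lambda>j. hook_length l (i, j)) ` {..<l ! i} = (\<lambda>n. x - n) ` y ` {..<l ! i}"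
    by (auto simp: image_image)
  with y_img show ?thesis by simp
qed

text \<open>A hook length in \<open>A\<close> is a difference \<open>x - y \<in> A\<close> with
  \<open>x\<close> in the beta set and \<open>y < x\<close> outside it; closure under subtraction
  excludes exactly these pairs.\<close>

lemma cores_iff: "l \<in> cores A \<longleftrightarrow> is_partition l \<and> sub_closed A (beta l)"
proof (cases "is_partition l")
  case l: True
  let ?x = "first_hook l"
  have "l \<in> cores A \<longleftrightarrow> (\<forall>i<length l. \<forall>h\<in>(\<lambda>j. hook_length l (i, j)) ` {..<l ! i}. h \<notin> A)"
    using l by (auto simp: cores_def young_diagram_def)
  also have "\<dots> \<longleftrightarrow> (\<forall>i<length l. \<forall>h\<in>(\<lambda>y. ?x i - y) ` {y. y < ?x i \<and> y \<notin> beta l}. h \<notin> A)"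
    using hook_lengths_row[OF l] by auto
  also have "\<dots> \<longleftrightarrow> (\<forall>x\<in>beta l. \<forall>y. y < x \<and> y \<notin> beta l \<longrightarrow> x - y \<notin> A)"
    by (auto simp: beta_def)
  also have "\<dots> \<longleftrightarrow> sub_closed A (beta l)"
  proof
    assume *: "\<forall>x\<in>beta l. \<forall>y. y < x \<and> y \<notin> beta l \<longrightarrow> x - y \<notin> A"
    show "sub_closed A (beta l)" unfolding sub_closed_def
    proof (intro ballI impI)
      fix x k assume "x \<in> beta l" "k \<in> A" "k \<le> x"
      then show "x - k \<in> beta l"
        using *[rule_format, of x "x - k"] by (cases "k = 0") auto
    qed
  next
    assume *: "sub_closed A (beta l)"
    show "\<forall>x\<in>beta l. \<forall>y. y < x \<and> y \<notin> beta l \<longrightarrow> x - y \<notin> A"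
    proof (intro ballI allI impI notI)
      fix x y assume "x \<in> beta l" "y < x \<and> y \<notin> beta l" "x - y \<in> A"
      then show False using * by (force simp: sub_closed_def)
    qed
  qed
  finally show ?thesis using l by simp
qed (simp add: cores_def)

text \<open>If \<open>d\<close> is the first hook of row \<open>i\<close>, its two counts are
  \<open>Suc i\<close> and \<open>l ! i\<close>. A cut \<open>t\<close> with counts at least as
  large for \<open>k\<close> shows that a rectangle of this size fits into \<open>k\<close>;
  \<open>t\<close> itself need not lie in \<open>beta k\<close>.\<close>

lemma subpartition_if_rectangles:
  assumes l: "is_partition l" and k: "is_partition k" and sub: "beta l \<subseteq> beta k"
    and rect: "\<And>d. d \<in> beta l \<Longrightarrow> \<exists>t. card {x \<in> beta l. d \<le> x} \<le> card {x \<in> beta k. t \<le> x} \<and>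
       card {n. n < d \<and> n \<notin> beta l} \<le> card {n. n < t \<and> n \<notin> beta k}"
  shows "subpartition l k"
proof -
  have len: "length l \<le> length k"
    using card_mono[OF _ sub] l k by (simp add: card_beta)
  have "l ! i \<le> k ! i" if i: "i < length l" for i
  proof -
    let ?d = "first_hook l i" and ?g = "first_hook k i"
    have ik: "i < length k" using i len by simp
    have "?d \<in> beta l" using i by (auto simp: beta_def)
    from rect[OF this] obtain t where t: "Suc i \<le> card {x \<in> beta k. t \<le> x}"
        "l ! i \<le> card {n. n < t \<and> n \<notin> beta k}"
      using card_beta_ge[OF l i] card_non_beta_less[OF l i] by auto
    \<comment> \<open>A cut above the first hook of row \<open>i\<close> would have at most
      \<open>i\<close> elements of \<open>beta k\<close> at or above it.\<close>
    have "t \<le> ?g"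
    proof (rule ccontr)
      assume "\<not> t \<le> ?g"
      moreover have "?g \<in> beta k" using ik by (auto simp: beta_def)
      ultimately have "{x \<in> beta k. t \<le> x} \<subset> {x \<in> beta k. ?g \<le> x}" by force
      then have "card {x \<in> beta k. t \<le> x} < card {x \<in> beta k. ?g \<le> x}"
        by (intro psubset_card_mono) auto
      with t(1) card_beta_ge[OF k ik] show False by simp
    qed
    then have "card {n. n < t \<and> n \<notin> beta k} \<le> card {n. n < ?g \<and> n \<notin> beta k}"
      by (intro card_mono) auto
    with t(2) card_non_beta_less[OF k ik] show ?thesis by simp
  qed
  with len show ?thesis by (simp add: subpartition_def)
qed

section \<open>The largest core for two coprime numbers\<close>

lemma mult_mod_coprime_surj:
  fixes a b n :: nat
  assumes "0 < a" "coprime a b"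
  obtains j where "j < a" "(j * b) mod a = n mod a"
proof -
  from assms(2) obtain x where x: "[b * x = 1] (mod a)"
    using cong_solve_coprime_nat[of b a] by (auto simp: coprime_commute)
  have "[b * x * n = 1 * n] (mod a)" using x by (rule cong_scalar_right)
  then have "((x * n) mod a * b) mod a = n mod a"
    by (simp add: cong_def mod_mult_right_eq mult.commute mult.left_commute)
  with assms(1) that[of "(x * n) mod a"] show thesis by simp
qed

text \<open>\<open>j * b\<close> is the least element of the semigroup in its class modulo
  \<open>a\<close>: in any \<open>x * a + y * b\<close> of this class, \<open>y\<close> is congruent
  to \<open>j\<close>, so \<open>j \<le> y\<close>.\<close>

lemma semigroup_gen_iff_ge:
  assumes "0 < a" "coprime a b" "j < a" "(j * b) mod a = n mod a"
  shows "n \<in> semigroup_gen a b \<longleftrightarrow> j * b \<le> n"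
proof
  assume "n \<in> semigroup_gen a b"
  then obtain x y where n: "n = x * a + y * b" by (auto simp: semigroup_gen_def)
  then have "[j * b = y * b] (mod a)" using assms(4) by (simp add: cong_def)
  then have "[j = y] (mod a)"
    using assms(2) cong_mult_rcancel_nat[of b a j y] by (simp add: coprime_commute)
  then have "j \<le> y" using assms(3) by (metis cong_def mod_less mod_less_eq_dividend)
  then show "j * b \<le> n" using n by (metis mult_le_mono1 trans_le_add2)
next
  assume le: "j * b \<le> n"
  then have "a dvd n - j * b" using assms(4) by (metis mod_eq_dvd_iff_nat)
  then obtain x where "n - j * b = a * x" by (rule dvdE)
  with le have "n = x * a + j * b" by (simp add: mult.commute)
  then show "n \<in> semigroup_gen a b" by (auto simp: semigroup_gen_def)
qed

lemma finite_gaps: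
  assumes "0 < a" "coprime a b"
  shows "finite (- semigroup_gen a b)"
proof (rule finite_subset)
  show "- semigroup_gen a b \<subseteq> {..<a * b}"
  proof
    fix n assume n: "n \<in> - semigroup_gen a b"
    obtain j where j: "j < a" "(j * b) mod a = n mod a"
      using mult_mod_coprime_surj[OF assms] .
    with n semigroup_gen_iff_ge[OF assms j] have "n < j * b" by simp
    also have "\<dots> \<le> a * b" using j(1) by simp
    finally show "n \<in> {..<a * b}" by simp
  qed
qed simp

text \<open>Let \<open>p r\<close> be the least non-element of \<open>X\<close> in the residue class \<open>r\<close> modulo \<open>a\<close>. Adding \<open>b\<close>
  moves cyclically through all classes and raises \<open>p\<close> by at most \<open>b\<close>, so consecutive values in the
  sorted list of the \<open>p r\<close> differ by at most \<open>b\<close>. For the semigroup itself, this list is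
  \<open>0, b, \<dots>, (a - 1) b\<close>, so matching classes by rank and then shifting by \<open>t - d\<close> moves the elements
  of \<open>X\<close> above \<open>d\<close> up and the non-elements below \<open>d\<close> down.\<close>

lemma rectangle_bound:
  fixes a b d :: nat
  assumes a: "0 < a" and cop: "coprime a b" and fin: "finite X" and X0: "0 \<notin> X"
    and closed: "sub_closed {a, b} X" and d: "d \<in> X"
  shows "\<exists>t. card {x \<in> X. d \<le> x} \<le> card {g \<in> - semigroup_gen a b. t \<le> g} \<and>
     card {n. n < d \<and> n \<notin> X} \<le> card {n. n < t \<and> n \<notin> - semigroup_gen a b}"
proof -
  have up: "n + a \<notin> X" "n + b \<notin> X" if "n \<notin> X" for n
    using closed that unfolding sub_closed_def by force+
  have up_mult: "n + k * a \<notin> X" if "n \<notin> X" for n k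
    using that by (induction k) (use up(1) in \<open>force simp: algebra_simps\<close>)+
  define p where "p n = (LEAST m. m \<notin> X \<and> m mod a = n mod a)" for n
  have "\<exists>m. m \<notin> X \<and> m mod a = n mod a" for n
  proof -
    have "inj (\<lambda>k. n + k * a)" using a by (auto intro: injI)
    then have "\<not> range (\<lambda>k. n + k * a) \<subseteq> X"
      using fin finite_imageD[of _ UNIV] finite_subset infinite_UNIV_nat by blast
    then obtain k where "n + k * a \<notin> X" by auto
    then show ?thesis by (intro exI[of _ "n + k * a"]) simp
  qed
  then have p: "p n \<notin> X \<and> p n mod a = n mod a" for n
    unfolding p_def by (rule LeastI_ex)
  have p_le: "p n \<le> m" if "m \<notin> X" "m mod a = n mod a" for n m
    unfolding p_def using that by (intro Least_le) simp
  have p_cong: "p n = p m" if "n mod a = m mod a" for n m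
    using that by (simp add: p_def)
  have p_add: "p (n + b) \<le> p n + b" for n
    using p[of n] up by (intro p_le) (auto intro: mod_add_cong)
  \<comment> \<open>Within a class the complement of \<open>X\<close> is \<open>p n\<close> and
    everything above it, by \<open>up_mult\<close>.\<close>
  have below: "p n > n" if "n \<in> X" for n
  proof (rule ccontr)
    assume "\<not> p n > n"
    then have le: "p n \<le> n" by simp
    have "a dvd n - p n" using p[of n] le mod_eq_dvd_iff_nat[of "p n" n a] by metis
    then obtain k where "n - p n = a * k" by (rule dvdE)
    then have "n = p n + k * a" using le by (simp add: mult.commute)
    with up_mult[of "p n" k] p[of n] that show False by simp
  qed

  define ps where "ps = sorted_list_of_set (p ` {..<a})"
  have inj: "inj_on p {..<a}"
  proof (rule inj_onI)
    fix r s assume "r \<in> {..<a}" "s \<in> {..<a}" "p r = p s"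
    then show "r = s" using p by (metis lessThan_iff mod_less)
  qed
  have len: "length ps = a" by (simp add: ps_def card_image[OF inj])
  have set_ps: "set ps = range p"
  proof -
    have "p n \<in> p ` {..<a}" for n
      using p_cong[of n "n mod a"] a by auto
    then show ?thesis by (auto simp: ps_def)
  qed
  have ps_less: "ps ! i < ps ! j" if "i < j" "j < a" for i j
    using that strict_sorted_list_of_set[of "p ` {..<a}"] len
    by (auto simp: ps_def sorted_wrt_iff_nth_less)
  have ps_le: "ps ! i \<le> ps ! j" if "i \<le> j" "j < a" for i j
    using ps_less[of i j] that by (cases "i = j") auto
  have "\<exists>i<a. ps ! i = p n" for n
    using set_ps len by (metis in_set_conv_nth rangeI)
  \<comment> \<open>\<open>rk n\<close> is the rank of the class of \<open>n\<close> when the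
    classes are sorted by \<open>p\<close>.\<close>
  then obtain rk where rk: "\<And>n. rk n < a" "\<And>n. ps ! rk n = p n" by metis

  \<comment> \<open>A jump by more than \<open>b\<close> after rank \<open>m\<close> would trap the
    orbit of \<open>n0\<close> under adding \<open>b\<close> in the ranks up to \<open>m\<close>,
    yet this orbit meets every class, also that of \<open>n1\<close>.\<close>
  have gap: "ps ! Suc m \<le> ps ! m + b" if m: "Suc m < a" for m
  proof (rule ccontr)
    assume far: "\<not> ps ! Suc m \<le> ps ! m + b"
    obtain n0 where n0: "ps ! m = p n0" using set_ps len m by (metis Suc_lessD nth_mem rangeE)
    obtain n1 where n1: "ps ! Suc m = p n1" using set_ps len m by (metis nth_mem rangeE)
    have low: "p (n0 + k * b) \<le> ps ! m" for k
    proof (induction k)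
      case 0
      then show ?case by (simp add: n0)
    next
      case (Suc k)
      have "ps ! rk (n0 + k * b + b) < ps ! Suc m"
        using p_add[of "n0 + k * b"] Suc far rk(2) by simp
      then have "rk (n0 + k * b + b) < Suc m"
        using ps_le[of "Suc m" "rk (n0 + k * b + b)"] rk(1) by (meson not_le)
      then have "ps ! rk (n0 + k * b + b) \<le> ps ! m" using m by (intro ps_le) auto
      then show ?case using rk(2) by (simp add: algebra_simps)
    qed
    \<comment> \<open>\<open>a - n0 mod a\<close> stands for \<open>- n0\<close>, so
      \<open>k * b\<close> is congruent to \<open>n1 - n0\<close>.\<close>
    obtain k where k: "(k * b) mod a = (n1 + (a - n0 mod a)) mod a"
      using mult_mod_coprime_surj[OF a cop] by metis
    have "(n0 + k * b) mod a = (n0 mod a + (n1 + (a - n0 mod a))) mod a"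
      using k by (metis mod_add_eq mod_mod_trivial)
    also have "n0 mod a + (n1 + (a - n0 mod a)) = n1 + a"
      using mod_less_divisor[OF a, of n0] by linarith
    finally have "p (n0 + k * b) = p n1" by (intro p_cong) simp
    with low[of k] n1 ps_less[of m "Suc m"] m show False by simp
  qed
  have gaps: "ps ! (m + i) \<le> ps ! m + i * b" if "m + i < a" for m i
    using that
  proof (induction i)
    case (Suc i)
    then show ?case using gap[of "m + i"] by simp
  qed simp

  define k where "k = (LEAST i. d \<le> ps ! i)"
  have dk: "d \<le> ps ! rk d" using below[OF d] rk(2) by simp
  have k: "d \<le> ps ! k" unfolding k_def using dk by (rule LeastI)
  have k_le: "k \<le> i" if "d \<le> ps ! i" for i
    unfolding k_def using that by (rule Least_le)
  have ka: "k < a" using k_le[OF dk] rk(1) le_less_trans by blast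
  have "p 0 = 0" using p_le[of 0 0] X0 by simp
  moreover have "ps ! 0 \<le> ps ! rk 0" using rk(1) by (intro ps_le) auto
  ultimately have "ps ! 0 < d" using rk(2) d X0 by (metis gr0I le_zero_eq)
  with k have "k \<noteq> 0" by (metis not_le)
  then have km: "ps ! (k - 1) < d" "ps ! k \<le> ps ! (k - 1) + b"
    using k_le[of "k - 1"] gap[of "k - 1"] ka by (cases "d \<le> ps ! (k - 1)"; simp)+
  \<comment> \<open>Chosen so that the shift from \<open>ps ! k\<close> to \<open>k * b\<close>
    moves \<open>d\<close> to \<open>t\<close>; the subtraction is exact because
    \<open>ps ! k < d + b\<close> and \<open>k\<close> is positive.\<close>
  define t where "t = d + k * b - ps ! k"
  have t: "t + ps ! k = d + k * b" using km \<open>k \<noteq> 0\<close> by (cases k) (auto simp: t_def)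

  \<comment> \<open>Keeps the signed distance to \<open>p n\<close> while moving \<open>p n\<close>
    to \<open>rk n * b\<close>, the least element of the semigroup in its own class.\<close>
  define \<phi> where "\<phi> n = rk n * b + n - p n" for n
  \<comment> \<open>From rank \<open>k\<close> on, \<open>p\<close> climbs by at most
    \<open>b\<close> per rank and \<open>rk n * b\<close> by exactly \<open>b\<close>. Below rank
    \<open>k\<close> the same comparison gives \<open>phi_lower\<close>.\<close>
  have phi_upper: "t + p n \<le> rk n * b + n" if "n \<in> X" "d \<le> n" for n
  proof -
    have "k \<le> rk n" using below[OF that(1)] that(2) rk(2) by (intro k_le) simp
    then obtain i where i: "rk n = k + i" using le_Suc_ex by blast
    then have "p n \<le> ps ! k + i * b" using gaps[of k i] rk by (metis)
    with t i that(2) show ?thesis by (simp add: algebra_simps)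
  qed
  have phi_lower: "p n \<le> n" "rk n * b + n < t + p n" if "n \<notin> X" "n < d" for n
  proof -
    show "p n \<le> n" using that by (intro p_le) auto
    with that have "rk n < k" using ps_le[of k "rk n"] rk k by (metis le_less_trans not_le)
    then obtain i where i: "k = rk n + i" using less_imp_add_positive by blast
    then have "ps ! k \<le> p n + i * b" using gaps[of "rk n" i] rk ka by metis
    with t i that(2) show "rk n * b + n < t + p n" by (simp add: algebra_simps)
  qed
  have phi_mod: "(rk n * b) mod a = \<phi> n mod a" if "p n \<le> rk n * b + n" for n
  proof -
    have "[\<phi> n + p n = rk n * b + n] (mod a)" using that by (simp add: \<phi>_def)
    moreover have "[p n = n] (mod a)" using p by (simp add: cong_def)
    ultimately have "[\<phi> n + n = rk n * b + n] (mod a)"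
      by (meson cong_add_lcancel_nat cong_add cong_refl cong_sym cong_trans)
    then have "[\<phi> n = rk n * b] (mod a)" by (simp only: cong_add_rcancel_nat)
    then show ?thesis by (simp add: cong_def)
  qed
  \<comment> \<open>The class of \<open>\<phi> n\<close> determines the rank, hence
    \<open>p n\<close>, hence \<open>n\<close>; the bounds exclude truncated subtraction.\<close>
  have phi_inj: "n = m" if "\<phi> n = \<phi> m" "p n \<le> rk n * b + n" "p m \<le> rk m * b + m" for n m
  proof -
    have "[rk n * b = rk m * b] (mod a)" using phi_mod that by (simp add: cong_def)
    then have "[rk n = rk m] (mod a)"
      using cop cong_mult_rcancel_nat[of b a] by (simp add: coprime_commute)
    then have "rk n = rk m" using rk(1) by (simp add: cong_def)
    moreover from this have "p n = p m" using rk(2) by metis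
    ultimately show ?thesis using that by (simp add: \<phi>_def)
  qed
  have "card {x \<in> X. d \<le> x} \<le> card {g \<in> - semigroup_gen a b. t \<le> g}"
  proof (rule card_inj_on_le)
    show "inj_on \<phi> {x \<in> X. d \<le> x}"
    proof (rule inj_onI)
      fix n m assume "n \<in> {x \<in> X. d \<le> x}" "m \<in> {x \<in> X. d \<le> x}" and eq: "\<phi> n = \<phi> m"
      then have "t + p n \<le> rk n * b + n" "t + p m \<le> rk m * b + m"
        by (simp_all add: phi_upper)
      then show "n = m" by (intro phi_inj[OF eq]) simp_all
    qed
    show "finite {g \<in> - semigroup_gen a b. t \<le> g}"
      by (rule finite_subset[OF _ finite_gaps[OF a cop]]) auto
    show "\<phi> ` {x \<in> X. d \<le> x} \<subseteq> {g \<in> - semigroup_gen a b. t \<le> g}"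
    proof safe
      fix n assume n: "n \<in> X" "d \<le> n"
      note u = phi_upper[OF n]
      show "t \<le> \<phi> n" using u by (simp add: \<phi>_def)
      assume "\<phi> n \<in> semigroup_gen a b"
      then have "rk n * b \<le> \<phi> n"
        using semigroup_gen_iff_ge[OF a cop rk(1) phi_mod] u by simp
      then show False using u below[OF n(1)] by (simp add: \<phi>_def)
    qed
  qed
  moreover have "card {n. n < d \<and> n \<notin> X} \<le> card {n. n < t \<and> n \<notin> - semigroup_gen a b}"
  proof (rule card_inj_on_le)
    show "inj_on \<phi> {n. n < d \<and> n \<notin> X}"
    proof (rule inj_onI)
      fix n m assume "n \<in> {n. n < d \<and> n \<notin> X}" "m \<in> {n. n < d \<and> n \<notin> X}" and eq: "\<phi> n = \<phi> m"
      then have "p n \<le> n" "p m \<le> m" by (simp_all add: phi_lower(1))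
      then show "n = m" by (intro phi_inj[OF eq]) (simp_all add: trans_le_add2)
    qed
    show "\<phi> ` {n. n < d \<and> n \<notin> X} \<subseteq> {n. n < t \<and> n \<notin> - semigroup_gen a b}"
    proof (rule image_subsetI)
      fix n assume "n \<in> {n. n < d \<and> n \<notin> X}"
      then have v: "p n \<le> n" "rk n * b + n < t + p n" using phi_lower by simp_all
      then have "\<phi> n < t" "rk n * b \<le> \<phi> n" by (simp_all add: \<phi>_def)
      then show "\<phi> n \<in> {n. n < t \<and> n \<notin> - semigroup_gen a b}"
        using semigroup_gen_iff_ge[OF a cop rk(1) phi_mod] v(1) by (simp add: trans_le_add2)
    qed
  qed simp
  ultimately show ?thesis by blast
qed

section \<open>Cores consist of gaps; the largest core when \<open>c\<close> is in the
  semigroup\<close>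

lemma sub_closed_multiple:
  assumes "sub_closed {a} X" "x \<in> X" "k * a \<le> x"
  shows "x - k * a \<in> X"
  using assms(3)
proof (induction k)
  case (Suc k)
  then have "x - k * a \<in> X" "a \<le> x - k * a" by auto
  then have "x - k * a - a \<in> X" using assms(1) by (auto simp: sub_closed_def)
  then show ?case by (simp add: diff_diff_left add.commute)
qed (use assms in simp)

text \<open>From an element of \<open>X\<close> in the semigroup, removing all copies of
  \<open>a\<close> and then all copies of \<open>b\<close> would lead to 0.\<close>

lemma sub_closed_subset_gaps:
  assumes "sub_closed {a, b} X" "0 \<notin> X"
  shows "X \<subseteq> - semigroup_gen a b"
proof
  fix n assume n: "n \<in> X"
  show "n \<in> - semigroup_gen a b"
  proof
    assume "n \<in> semigroup_gen a b"
    then obtain x y where xy: "n = x * a + y * b" by (auto simp: semigroup_gen_def)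
    have ab: "sub_closed {a} X" "sub_closed {b} X" using assms(1) by (auto simp: sub_closed_def)
    have "n - x * a \<in> X" using sub_closed_multiple[OF ab(1) n, of x] xy by simp
    with sub_closed_multiple[OF ab(2) this, of y] xy assms(2) show False by simp
  qed
qed

lemma semigroup_gen_add:
  assumes "m \<in> semigroup_gen a b" "n \<in> semigroup_gen a b"
  shows "m + n \<in> semigroup_gen a b"
proof -
  from assms obtain x y x' y' where "m = x * a + y * b" "n = x' * a + y' * b"
    by (auto simp: semigroup_gen_def)
  then have "m + n = (x + x') * a + (y + y') * b" by (simp add: algebra_simps)
  then show ?thesis unfolding semigroup_gen_def by blast
qed

lemma UM_if_in_semigroup:
  assumes a: "0 < a" and cop: "coprime a b" and c: "c \<in> semigroup_gen a b"
  shows "UM {a, b, c}"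
proof -
  let ?S = "semigroup_gen a b"
  have abS: "{a, b, c} \<subseteq> ?S"
    using c by (auto simp: semigroup_gen_def intro: exI[of _ 1] exI[of _ 0])
  have "0 \<in> ?S" by (auto simp: semigroup_gen_def)
  then obtain k where k: "is_partition k" "beta k = - ?S"
    using ex_partition_beta[OF finite_gaps[OF a cop]] by auto
  have "sub_closed {a, b, c} (- ?S)" unfolding sub_closed_def
  proof (intro ballI impI)
    fix x s assume *: "x \<in> - ?S" "s \<in> {a, b, c}" "s \<le> x"
    then show "x - s \<in> - ?S" using semigroup_gen_add[of "x - s" a b s] abS by auto
  qed
  then have "k \<in> cores {a, b, c}" using k by (simp add: cores_iff)
  moreover have "subpartition l k" if "l \<in> cores {a, b, c}" for l
  proof -
    \<comment> \<open>Dropping \<open>c\<close> only weakens closure, so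
      \<open>rectangle_bound\<close> applies.\<close>
    from that have l: "is_partition l" "sub_closed {a, b} (beta l)"
      by (auto simp: cores_iff sub_closed_def)
    note l0 = zero_notin_beta[OF l(1)]
    show ?thesis
    proof (rule subpartition_if_rectangles[OF l(1) k(1)])
      show "beta l \<subseteq> beta k" using sub_closed_subset_gaps[OF l(2) l0] k(2) by simp
    next
      fix d assume "d \<in> beta l"
      then show "\<exists>t. card {x \<in> beta l. d \<le> x} \<le> card {x \<in> beta k. t \<le> x} \<and>
         card {n. n < d \<and> n \<notin> beta l} \<le> card {n. n < t \<and> n \<notin> beta k}"
        unfolding k(2) by (rule rectangle_bound[OF a cop finite_beta l0 l(2)])
    qed
  qed
  ultimately show ?thesis by (auto simp: UM_def)
qed

section \<open>Symmetric semigroups\<close>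

definition semigroup_gen3 :: "nat \<Rightarrow> nat \<Rightarrow> nat \<Rightarrow> nat set" where
  "semigroup_gen3 a b c = {x * a + y * b + z * c | x y z. True}"

lemma semigroup_gen3I: "n = x * a + y * b + z * c \<Longrightarrow> n \<in> semigroup_gen3 a b c"
  unfolding semigroup_gen3_def by blast

lemma semigroup_gen3_add:
  assumes "m \<in> semigroup_gen3 a b c" "n \<in> semigroup_gen3 a b c"
  shows "m + n \<in> semigroup_gen3 a b c"
proof -
  from assms obtain x y z x' y' z' where
    "m = x * a + y * b + z * c" "n = x' * a + y' * b + z' * c"
    by (auto simp: semigroup_gen3_def)
  then have "m + n = (x + x') * a + (y + y') * b + (z + z') * c" by (simp add: algebra_simps)
  then show ?thesis by (rule semigroup_gen3I)
qed

lemma sub_closed_subset_gaps3: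
  assumes "sub_closed {a, b, c} X" "0 \<notin> X"
  shows "X \<subseteq> - semigroup_gen3 a b c"
proof
  fix n assume n: "n \<in> X"
  show "n \<in> - semigroup_gen3 a b c"
  proof
    assume "n \<in> semigroup_gen3 a b c"
    then obtain x y z where xyz: "n = x * a + y * b + z * c" by (auto simp: semigroup_gen3_def)
    have abc: "sub_closed {c} X" "sub_closed {a, b} X" using assms(1) by (auto simp: sub_closed_def)
    have "n - z * c \<in> X" using sub_closed_multiple[OF abc(1) n, of z] xyz by simp
    then have "x * a + y * b \<in> X" using xyz by simp
    with sub_closed_subset_gaps[OF abc(2) assms(2)] show False
      unfolding semigroup_gen_def by blast
  qed
qed

text \<open>The conjugate of the partition with beta set \<open>- S\<close> has beta set \<open>F - S\<close>; comparing the first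
  rows of both shows that at most half of \<open>{0..F}\<close> are gaps.\<close>

lemma symmetric_if_UM:
  assumes UM: "UM {a, b, c}" and fin: "finite (- semigroup_gen3 a b c)"
    and F: "F \<notin> semigroup_gen3 a b c" "\<And>n. F < n \<Longrightarrow> n \<in> semigroup_gen3 a b c"
    and n: "n \<le> F" "n \<notin> semigroup_gen3 a b c"
  shows "F - n \<in> semigroup_gen3 a b c"
proof -
  define S where "S = semigroup_gen3 a b c"
  have S0: "0 \<in> S" unfolding S_def by (rule semigroup_gen3I[of _ 0 _ 0 _ 0]) simp
  have gen: "{a, b, c} \<subseteq> S"
    using semigroup_gen3I[of a 1 a 0 b 0 c] semigroup_gen3I[of b 0 a 1 b 0 c]
      semigroup_gen3I[of c 0 a 0 b 1 c] by (auto simp: S_def)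
  have add: "m + s \<in> S" if "m \<in> S" "s \<in> S" for m s
    using that semigroup_gen3_add by (simp add: S_def)
  obtain k where k: "k \<in> cores {a, b, c}" "\<And>l. l \<in> cores {a, b, c} \<Longrightarrow> subpartition l k"
    using UM by (auto simp: UM_def)
  from k(1) have kp: "is_partition k" and kc: "sub_closed {a, b, c} (beta k)"
    by (auto simp: cores_iff)
  have core_le: "length l \<le> length k" "i < length l \<Longrightarrow> l ! i \<le> k ! i"
    if "is_partition l" "sub_closed {a, b, c} (beta l)" for l i
    using k(2)[of l] that by (auto simp: cores_iff subpartition_def)

  obtain g where g: "is_partition g" "beta g = - S"
    using ex_partition_beta[OF fin] S0 by (auto simp: S_def)
  have "sub_closed {a, b, c} (- S)" unfolding sub_closed_def
  proof (intro ballI impI)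
    fix x s assume "x \<in> - S" "s \<in> {a, b, c}" "s \<le> x"
    then show "x - s \<in> - S" using add[of "x - s" s] gen by auto
  qed
  then have "card (- S) \<le> card (beta k)"
    using core_le(1)[of g] g card_beta[OF g(1)] card_beta[OF kp] by simp
  moreover have "beta k \<subseteq> - S"
    using sub_closed_subset_gaps3[OF kc zero_notin_beta[OF kp]] by (simp add: S_def)
  \<comment> \<open>The largest core is at least as long as \<open>g\<close>, so its beta set has at
    least as many elements as there are gaps, and it contains only gaps.\<close>
  ultimately have kS: "beta k = - S"
    using fin by (intro card_seteq) (auto simp: S_def)

  define Y where "Y = {y. y \<le> F \<and> F - y \<in> S}"
  have "finite Y" by (rule finite_subset[of _ "{..F}"]) (auto simp: Y_def)
  moreover have "0 \<notin> Y" using F(1) by (simp add: Y_def S_def)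
  ultimately obtain l where l: "is_partition l" "beta l = Y"
    using ex_partition_beta by blast
  have "sub_closed {a, b, c} Y" unfolding sub_closed_def
  proof (intro ballI impI)
    fix y s assume *: "y \<in> Y" "s \<in> {a, b, c}" "s \<le> y"
    then have "F - (y - s) = F - y + s" by (auto simp: Y_def)
    with * gen add[of "F - y" s] show "y - s \<in> Y" by (auto simp: Y_def)
  qed
  moreover have FY: "F \<in> Y" using S0 by (simp add: Y_def)
  moreover have l_ne: "0 < length l" using FY l(2) by (auto simp: beta_def)
  ultimately have row0: "l ! 0 \<le> k ! 0" using core_le(2)[OF l(1), of 0] l(2) by simp
  have top: "first_hook q 0 = F"
    if "is_partition q" "0 < length q" "F \<in> beta q" "\<And>x. x \<in> beta q \<Longrightarrow> x \<le> F" for q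
  proof -
    from that(3) obtain i where i: "i < length q" "F = first_hook q i"
      by (auto simp: beta_def)
    moreover have "first_hook q 0 \<in> beta q" using that(2) unfolding beta_def by blast
    ultimately show ?thesis
      using that(4) beta_le_iff[OF that(1) that(2) i(1)] by fastforce
  qed
  have k_le: "x \<le> F" if "x \<in> beta k" for x
    using that F(2) kS by (metis ComplD S_def not_le)
  have Fk: "F \<in> beta k" using F(1) kS by (simp add: S_def)
  then have k_ne: "0 < length k" by (auto simp: beta_def)
  have k_top: "first_hook k 0 = F" by (rule top[OF kp k_ne Fk k_le])
  have l_top: "first_hook l 0 = F"
    by (rule top[OF l(1) l_ne]) (use FY l(2) in \<open>auto simp: Y_def\<close>)
  have "card {n. n < F \<and> n \<notin> Y} = l ! 0"
    using card_non_beta_less[OF l(1) l_ne] unfolding l_top l(2) .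
  moreover have "card {n. n < F \<and> n \<in> S} = k ! 0"
    using card_non_beta_less[OF kp k_ne] unfolding k_top kS by simp
  moreover have "{n. n < F \<and> n \<notin> Y} = {n. n < F \<and> F - n \<notin> S}" by (auto simp: Y_def)
  ultimately have "card {n. n < F \<and> F - n \<notin> S} \<le> card {n. n < F \<and> n \<in> S}"
    using row0 by simp
  \<comment> \<open>\<open>n\<close> and \<open>F - n\<close> cannot both lie in \<open>S\<close>,
    which gives one inclusion; the comparison of first rows turns it into equality.\<close>
  moreover have disj: "n \<notin> S" if "F - n \<in> S" "n \<le> F" for n
    using that add[of "F - n" n] F(1) by (auto simp: S_def)
  then have "{n. n < F \<and> n \<in> S} \<subseteq> {n. n < F \<and> F - n \<notin> S}" by auto
  ultimately have eq: "{n. n < F \<and> n \<in> S} = {n. n < F \<and> F - n \<notin> S}"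
    by (intro card_seteq) auto
  show ?thesis
  proof (cases "n = F")
    case False
    then have "n < F" using n(1) by simp
    with eq n(2) show ?thesis by (auto simp: S_def)
  qed (use S0 in \<open>simp add: S_def\<close>)
qed

section \<open>Herzog's argument for three generators\<close>

lemma ex_least_multiple:
  assumes "0 < (k0 :: nat)" "k0 * a \<in> semigroup_gen b c"
  obtains k r s where "0 < k" "k \<le> k0" "k * a = r * b + s * c"
    "\<And>j r' s'. 0 < j \<Longrightarrow> j * a = r' * b + s' * c \<Longrightarrow> k \<le> j"
proof -
  define P where "P k \<longleftrightarrow> 0 < k \<and> k * a \<in> semigroup_gen b c" for k
  have P0: "P k0" using assms by (simp add: P_def)
  have "P (LEAST k. P k)" using P0 by (rule LeastI)
  moreover from this obtain r s where "(LEAST k. P k) * a = r * b + s * c"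
    by (auto simp: P_def semigroup_gen_def)
  moreover have "(LEAST k. P k) \<le> j" if "0 < j" "j * a = r' * b + s' * c" for j r' s'
    using that by (intro Least_le) (auto simp: P_def semigroup_gen_def)
  moreover have "(LEAST k. P k) \<le> k0" using P0 by (rule Least_le)
  ultimately show thesis using that by (auto simp: P_def)
qed

text \<open>With \<open>k1 a\<close>, \<open>k2 b\<close>, \<open>k3 c\<close> the least multiples lying in the
  semigroup of the two other generators, symmetry forces \<open>F + a = (k2 - 1) b + (k3 - 1) c\<close>,
  from which the relation for \<open>k1 a\<close> can be split off.\<close>

lemma in_semigroup_if_symmetric:
  fixes a b c F :: nat
  assumes a: "0 < a" "a < b" "b < c" and cop: "coprime a b" "coprime a c" "coprime b c"
    and F: "F \<notin> semigroup_gen3 a b c" "\<And>n. F < n \<Longrightarrow> n \<in> semigroup_gen3 a b c"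
    and sym: "\<And>n. n \<le> F \<Longrightarrow> n \<notin> semigroup_gen3 a b c \<Longrightarrow> F - n \<in> semigroup_gen3 a b c"
  shows "c \<in> semigroup_gen a b"
proof (rule ccontr)
  let ?S = "semigroup_gen3 a b c"
  assume c: "c \<notin> semigroup_gen a b"
  \<comment> \<open>Removing one copy of \<open>a\<close> from such a representation would represent
    \<open>F\<close>.\<close>
  have Fa: False if "F + a = x * a + y * b + z * c" "0 < x" for x y z
  proof -
    from that have "F = (x - 1) * a + y * b + z * c" by (cases x) auto
    with F(1) semigroup_gen3I show False by blast
  qed
  \<comment> \<open>These \<open>n\<close> are the least elements of \<open>?S\<close> in their
    classes modulo \<open>a\<close>. Symmetry at \<open>n - a\<close> puts \<open>F + a - n\<close>
    into \<open>?S\<close>, and by \<open>Fa\<close> it uses no \<open>a\<close>.\<close>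
  have sym_a: "\<exists>v w. F + a = n + v * b + w * c" if n: "n \<in> ?S" "\<And>m. m \<in> ?S \<Longrightarrow> n \<noteq> m + a" for n
  proof -
    have "n \<le> F + a"
    proof (rule ccontr)
      assume "\<not> n \<le> F + a"
      then have "n - a \<in> ?S" "n = (n - a) + a" using F(2)[of "n - a"] by auto
      with n(2) show False by blast
    qed
    moreover have "F + a - n \<in> ?S"
    proof (cases "n < a")
      case True
      then show ?thesis using F(2) by simp
    next
      case False
      then have "n - a \<notin> ?S" using n(2)[of "n - a"] by auto
      with sym[of "n - a"] \<open>n \<le> F + a\<close> False show ?thesis by (simp add: le_diff_conv)
    qed
    then obtain u v w where uvw: "F + a - n = u * a + v * b + w * c"
      by (auto simp: semigroup_gen3_def)
    obtain x y z where "n = x * a + y * b + z * c" using n(1) by (auto simp: semigroup_gen3_def)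
    with uvw \<open>n \<le> F + a\<close> have "F + a = (u + x) * a + (v + y) * b + (w + z) * c"
      by (simp add: algebra_simps)
    with Fa[of "u + x"] have "u = 0" by blast
    with uvw \<open>n \<le> F + a\<close> show ?thesis by (intro exI[of _ v] exI[of _ w]) simp
  qed

  \<comment> \<open>Here \<open>c \<notin> semigroup_gen a b\<close> enters: it gives
    \<open>c < j * a\<close>, so \<open>j * a\<close> is \<open>c\<close> plus a multiple of
    \<open>b\<close>, and hence \<open>k1 \<le> j < b\<close>.\<close>
  obtain j where j: "j < b" "(j * a) mod b = c mod b"
    using mult_mod_coprime_surj[of b a c] a cop(1) by (auto simp: coprime_commute)
  have "semigroup_gen b a = semigroup_gen a b"
    unfolding semigroup_gen_def by (metis add.commute)
  then have cj: "c < j * a"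
    using semigroup_gen_iff_ge[of b a j c] a cop(1) j c by (simp add: coprime_commute)
  then have "b dvd j * a - c" using j(2) mod_eq_dvd_iff_nat[of c "j * a" b] by simp
  then obtain e where "j * a - c = b * e" by (rule dvdE)
  with cj have "j * a = e * b + 1 * c" by (simp add: mult.commute)
  then have "j * a \<in> semigroup_gen b c" unfolding semigroup_gen_def by blast
  moreover have "0 < j" using cj by (cases j) auto
  ultimately obtain k1 r12 r13 where k1: "0 < k1" "k1 \<le> j" "k1 * a = r12 * b + r13 * c"
    and k1_min: "\<And>i r s. 0 < i \<Longrightarrow> i * a = r * b + s * c \<Longrightarrow> k1 \<le> i"
    using ex_least_multiple by metis
  have "a * b = b * a + 0 * c" by simp
  then have "a * b \<in> semigroup_gen a c" unfolding semigroup_gen_def by blast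
  then obtain k2 r21 r23 where k2: "0 < k2" "k2 \<le> a" "k2 * b = r21 * a + r23 * c"
    and k2_min: "\<And>i r s. 0 < i \<Longrightarrow> i * b = r * a + s * c \<Longrightarrow> k2 \<le> i"
    using ex_least_multiple[OF a(1)] by metis
  have "a * c = c * a + 0 * b" by simp
  then have "a * c \<in> semigroup_gen a b" unfolding semigroup_gen_def by blast
  then obtain k3 r31 r32 where k3: "0 < k3" "k3 \<le> a" "k3 * c = r31 * a + r32 * b"
    and k3_min: "\<And>i r s. 0 < i \<Longrightarrow> i * c = r * a + s * b \<Longrightarrow> k3 \<le> i"
    using ex_least_multiple[OF a(1)] by metis

  have no_dvd: False if "k * x = r * y" "coprime y x" "0 < k" "k < y" for k x r y :: nat
  proof -
    have "y dvd k * x" using that(1) by simp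
    with that(2) have "y dvd k" by (simp add: coprime_dvd_mult_left_iff)
    with that(3,4) show False by (simp add: nat_dvd_not_less)
  qed
  \<comment> \<open>Were one of the next four coefficients zero, two generators alone would satisfy
    a relation too short for coprime numbers.\<close>
  have r13: "0 < r13"
    using no_dvd[of k1 a r12 b] k1 j cop(1) by (cases r13) (auto simp: coprime_commute)
  have r12: "0 < r12"
    using no_dvd[of k1 a r13 c] k1 j a cop(2) by (cases r12) (auto simp: coprime_commute)
  have r21: "0 < r21"
    using no_dvd[of k2 b r23 c] k2 a cop(3) by (cases r21) (auto simp: coprime_commute)
  have r31: "0 < r31"
    using no_dvd[of k3 c r32 b] k3 a cop(3) by (cases r31) (auto simp: coprime_commute)

  \<comment> \<open>\<open>k2\<close> copies of \<open>b\<close> could be traded for a combination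
    with \<open>r21 > 0\<close> copies of \<open>a\<close>, which \<open>Fa\<close> forbids.\<close>
  have b_bound: "v < k2" if "F + a = v * b + w * c" for v w
  proof (rule ccontr)
    assume "\<not> v < k2"
    then have "v = k2 + (v - k2)" by simp
    then have "v * b = r21 * a + r23 * c + (v - k2) * b" using k2(3) by (metis add_mult_distrib)
    with that have "F + a = r21 * a + (v - k2) * b + (r23 + w) * c" by (simp add: algebra_simps)
    with r21 Fa show False by blast
  qed
  have c_bound: "w < k3" if "F + a = v * b + w * c" for v w
  proof (rule ccontr)
    assume "\<not> w < k3"
    then have "w = k3 + (w - k3)" by simp
    then have "w * c = r31 * a + r32 * b + (w - k3) * c" using k3(3) by (metis add_mult_distrib)
    with that have "F + a = r31 * a + (r32 + v) * b + (w - k3) * c" by (simp add: algebra_simps)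
    with r31 Fa show False by blast
  qed
  \<comment> \<open>\<open>sym_a\<close> applies: if \<open>(k2 - 1) * b\<close> were
    \<open>m + a\<close>, cancelling copies of \<open>b\<close> would leave a positive multiple of
    \<open>b\<close> in \<open>semigroup_gen a c\<close> below \<open>k2 * b\<close>.\<close>
  have "\<exists>v w. F + a = (k2 - 1) * b + v * b + w * c"
  proof (rule sym_a)
    show "(k2 - 1) * b \<in> ?S" by (rule semigroup_gen3I[of _ 0 _ "k2 - 1" _ 0]) simp
    fix m assume "m \<in> ?S"
    then obtain x y z where m: "m = x * a + y * b + z * c" by (auto simp: semigroup_gen3_def)
    show "(k2 - 1) * b \<noteq> m + a"
    proof
      assume "(k2 - 1) * b = m + a"
      then have "(k2 - 1) * b = (x + 1) * a + z * c + y * b" using m by simp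
      then have *: "(k2 - 1 - y) * b = (x + 1) * a + z * c" by (simp add: diff_mult_distrib)
      with a(1) have "0 < k2 - 1 - y" by (intro gr0I) simp
      with k2_min[OF _ *] k2(1) show False by simp
    qed
  qed
  then obtain v w where "F + a = (k2 - 1) * b + v * b + w * c" by blast
  then have "F + a = (k2 - 1 + v) * b + w * c" by (simp add: add_mult_distrib)
  with b_bound[OF this] have eq2: "F + a = (k2 - 1) * b + w * c" and "w < k3"
    using c_bound by auto
  have "\<exists>v w. F + a = (k3 - 1) * c + v * b + w * c"
  proof (rule sym_a)
    show "(k3 - 1) * c \<in> ?S" by (rule semigroup_gen3I[of _ 0 _ 0 _ "k3 - 1"]) simp
    fix m assume "m \<in> ?S"
    then obtain x y z where m: "m = x * a + y * b + z * c" by (auto simp: semigroup_gen3_def)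
    show "(k3 - 1) * c \<noteq> m + a"
    proof
      assume "(k3 - 1) * c = m + a"
      then have "(k3 - 1) * c = (x + 1) * a + y * b + z * c" using m by simp
      then have *: "(k3 - 1 - z) * c = (x + 1) * a + y * b" by (simp add: diff_mult_distrib)
      with a(1) have "0 < k3 - 1 - z" by (intro gr0I) simp
      with k3_min[OF _ *] k3(1) show False by simp
    qed
  qed
  then obtain v' w' where "F + a = (k3 - 1) * c + v' * b + w' * c" by blast
  then have "F + a = v' * b + (k3 - 1 + w') * c" by (simp add: add_mult_distrib)
  with c_bound[OF this] have eq3: "F + a = v' * b + (k3 - 1) * c" and "v' < k2"
    using b_bound by auto
  \<comment> \<open>Compares the two representations of \<open>F + a\<close>: as \<open>c\<close> is
    coprime to \<open>b\<close> and exceeds \<open>k2 - 1 - v'\<close>, both sides vanish.\<close>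
  have "(k2 - 1 - v') * b = (k3 - 1 - w) * c"
    using eq2 eq3 \<open>w < k3\<close> \<open>v' < k2\<close> by (simp add: diff_mult_distrib)
  moreover have "k2 - 1 - v' < c" using k2(2) a by linarith
  ultimately have "\<not> 0 < k2 - 1 - v'"
    using no_dvd[of "k2 - 1 - v'" b "k3 - 1 - w" c] cop(3) by (auto simp: coprime_commute)
  then have "v' = k2 - 1" using \<open>v' < k2\<close> by simp
  then have eq: "F + a = (k2 - 1) * b + (k3 - 1) * c" using eq3 by simp

  \<comment> \<open>Otherwise trading \<open>k2 * b\<close> and cancelling \<open>r21 * a\<close>
    gives a multiple of \<open>a\<close> contradicting the minimality of \<open>k1\<close>; it is
    positive since \<open>r13 * c\<close> remains.\<close>
  have "r12 < k2"
  proof (rule ccontr)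
    assume "\<not> r12 < k2"
    then have "r12 = k2 + (r12 - k2)" by simp
    then have "r12 * b = r21 * a + r23 * c + (r12 - k2) * b"
      using k2(3) by (metis add_mult_distrib)
    then have "k1 * a = r21 * a + ((r12 - k2) * b + (r23 + r13) * c)"
      using k1(3) by (simp add: algebra_simps)
    then have *: "(k1 - r21) * a = (r12 - k2) * b + (r23 + r13) * c" by (simp add: diff_mult_distrib)
    with r13 a have "0 < k1 - r21" by (intro gr0I) simp
    with k1_min[OF _ *] r21 show False by simp
  qed
  moreover have "r13 < k3"
  proof (rule ccontr)
    assume "\<not> r13 < k3"
    then have "r13 = k3 + (r13 - k3)" by simp
    then have "r13 * c = r31 * a + r32 * b + (r13 - k3) * c"
      using k3(3) by (metis add_mult_distrib)
    then have "k1 * a = r31 * a + ((r32 + r12) * b + (r13 - k3) * c)"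
      using k1(3) by (simp add: algebra_simps)
    then have *: "(k1 - r31) * a = (r32 + r12) * b + (r13 - k3) * c" by (simp add: diff_mult_distrib)
    with r12 a have "0 < k1 - r31" by (intro gr0I) simp
    with k1_min[OF _ *] r31 show False by simp
  qed
  ultimately have "k2 - 1 = r12 + (k2 - 1 - r12)" "k3 - 1 = r13 + (k3 - 1 - r13)" by auto
  then have "F + a = r12 * b + r13 * c + (k2 - 1 - r12) * b + (k3 - 1 - r13) * c"
    using eq by (metis (no_types, lifting) add.assoc add.left_commute add_mult_distrib)
  with k1(3) have "F + a = k1 * a + (k2 - 1 - r12) * b + (k3 - 1 - r13) * c" by simp
  with k1(1) Fa show False by blast
qed

theorem corollary1p4:
  fixes a b c :: nat
  assumes "0 < a" and "a < b" and "b < c"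
    and "coprime a b" and "coprime a c" and "coprime b c"
  shows "UM_triple a b c \<longleftrightarrow> c \<in> semigroup_gen a b"
proof
  assume "c \<in> semigroup_gen a b"
  then show "UM_triple a b c"
    using UM_if_in_semigroup[OF assms(1,4)] by (simp add: UM_triple_def)
next
  let ?S = "semigroup_gen3 a b c"
  assume UM: "UM_triple a b c"
  have "semigroup_gen a b \<subseteq> ?S"
    by (auto simp: semigroup_gen_def intro: semigroup_gen3I[where z = 0])
  then have fin: "finite (- ?S)"
    using finite_gaps[OF assms(1,4)] by (meson Compl_subset_Compl_iff finite_subset)
  show "c \<in> semigroup_gen a b"
  proof (cases "- ?S = {}")
    \<comment> \<open>Without gaps there is no \<open>F\<close>; then 1 lies in the semigroup, which
      forces \<open>a = 1\<close>.\<close>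
    case True
    then obtain x y z where xyz: "1 = x * a + y * b + z * c"
      unfolding semigroup_gen3_def by blast
    have "y = 0" "z = 0" using xyz assms(1-3) by (cases y; cases z; simp)+
    then have "a = 1" using xyz by simp
    then have "c = c * a + 0 * b" by simp
    then show ?thesis unfolding semigroup_gen_def by blast
  next
    case False
    define F where "F = Max (- ?S)"
    have F: "F \<notin> ?S" using Max_in[OF fin False] by (simp add: F_def)
    have above: "n \<in> ?S" if "F < n" for n
      using that Max_ge[OF fin, of n] by (force simp: F_def)
    show ?thesis
      using symmetric_if_UM[OF _ fin F above] UM F above
      by (intro in_semigroup_if_symmetric[OF assms]) (auto simp: UM_triple_def)
  qed
qed

end
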